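(* The tableau calculus $\mathbf{TAB}_{\mathbf{I4D}}$ is complete for the class of all unbounded strict partially ordered (USPO) models; that is, every formula $\varphi$ that is true at every world of every USPO model is provable in $\mathbf{TAB}_{\mathbf{I4D}}$.
   Context: **Formulas.** Let $\mathbf{Prop}$ (propositional variables) and $\mathbf{Nom}$ (nominals) be disjoint countably infinite sets. Formulas are $\varphi ::= p \mid i \mid \neg\varphi \mid \varphi\land\varphi \mid \varphi\lor\varphi \mid \Diamond\varphi \mid \Box\varphi \mid @_i\varphi$ with $p\in\mathbf{Prop}$, $i\in\mathbf{Nom}$. All formulas are taken in negation normal form (NNF: negation only in front of propositional variables and nominals; $\neg @_i\varphi$ is rewritten as $@_i\neg\varphi$, Boolean and modal operators as usual), and $\neg\varphi$ denotes the NNF of the negation of $\varphi$. **Semantics.** A model $\mathcal M=(W,R,V)$ has a non-empty set $W$, a binary relation $R$ on $W$, and $V:\mathbf{Prop}\cup\mathbf{Nom}\to\mathcal P(W)$ with $V(i)=\{i^V\}$ a singleton for each $i\in\mathbf{Nom}$. Satisfaction: $\mathcal M,w\models p$ iff $w\in V(p)$; $\mathcal M,w\models i$ iff $w=i^V$; Boolean connectives as usual; $\mathcal M,w\models\Diamond\varphi$ iff $\mathcal M,v\models\varphi$ for some $v$ with $wRv$; $\mathcal M,w\models\Box\varphi$ iff $\mathcal M,v\models\varphi$ for all $v$ with $wRv$; $\mathcal M,w\models@_i\varphi$ iff $\mathcal M,i^V\models\varphi$. A USPO model is a model whose $R$ is serial ($\forall x\exists y\; xRy$), irreflexive and transitive.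 **Tableaus.** A tableau is a tree of formulas, built downwards from a root formula $@_i\varphi$, where $i\in\mathbf{Nom}$ does not occur in $\varphi$, by extending branches with the rules below (branches may a priori be infinite). We write $\varphi\in\Theta$ if $\varphi$ occurs in the branch $\Theta$. A branch $\Theta$ is closed if $@_i\varphi, @_i\neg\varphi\in\Theta$ for some $\varphi$, $i$; otherwise it is open. A tableau is closed if all its branches are closed. A closed branch is not extended, nor is a branch on which every formula that could be generated by applying a rule already exists; rules are not applied redundantly: each application must add a formula not already on the branch to every branch it produces. A formula $\varphi$ is provable if there is a closed tableau with root formula $@_i\neg\varphi$, where $i\in\mathbf{Nom}$ does not occur in $\varphi$. **Rules of $\mathbf{TAB}_{\mathbf{I4D}}$** (premises are on the branch; conclusions are added to it): - $[Eq]$: add $@_i i$, for any nominal $i$ already occurring in the branch. - $[\land]$: from $@_i(\varphi\land\psi)$ add $@_i\varphi$ and $@_i\psi$. - $[\lor]$: from $@_i(\varphi\lor\psi)$ split the branch, adding $@_i\varphi$ on one side and $@_i\psi$ on the other. - $[\Diamond]$: from $@_i\Diamond\varphi$ which is not an accessibility formula, add $@_i\Diamond j$ and $@_j\varphi$, where $j$ is a nominal not occurring in the branch; it is applied at most once per formula. The formula $@_i\Diamond j$ so produced is called an accessibility formula. - $[\Box]$: from $@_i\Box\varphi$ and $@_i\Diamond j$ add $@_j\varphi$. - $[@]$: from $@_i@_j\varphi$ add $@_j\varphi$. - $[Id]$: from $@_i\varphi$, not an accessibility formula, and $@_i j$ add $@_j\varphi$. - $[Irr]$: add $@_i\Box\neg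 i$, for any nominal $i$ already occurring in the branch. - $[Trs]$: from $@_i\Box\varphi$ and $@_i\Diamond j$ add $@_j\Box\varphi$. - $[Ser]$: add $@_i\Diamond j$, where $i$ is already present in the branch while $j$ is not; it can be applied only once per nominal $i$. - Restriction $(\mathcal D)$: $[\Diamond]$ can be applied to $@_i\Diamond\varphi$ on a branch $\Theta$ only if $i$ is a quasi-urfather on $\Theta$ (at the moment of application). **Quasi-urfathers.** $@_i\varphi$ is a prefixed subformula of $@_j\psi$ if $\varphi$ is a subformula of $\psi$. For a nominal $i$ occurring in $\Theta$, $T^\Theta(i)=T_1^\Theta(i)\cup T_2^\Theta(i)$, where $T_1^\Theta(i)$ is the set of $\varphi$ such that $@_i\varphi\in\Theta$ is a prefixed subformula of the root formula of $\Theta$, and $T_2^\Theta(i)$ is the set of $\psi$ such that $@_i\psi\in\Theta$ is a prefixed subformula of $@_j\Box\neg j$ for some $j$ occurring in the root formula. Nominals $i,j$ are twins in $\Theta$ if $T^\Theta(i)=T^\Theta(j)$. Write $i\prec_\Theta j$ if $j$ is introduced in $\Theta$ by applying $[\Diamond]$ to some $@_i\Diamond\varphi$; $\prec_\Theta^*$ is the reflexive transitive closure. A nominal $i$ is a quasi-urfather on $\Theta$ if there are no twins $j\neq k$ with $j\prec_\Theta^* i$ and $k\prec_\Theta^* i$. *)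

theory Defs
  imports Main
begin

text \<open>Propositional variables and nominals are two copies of the natural numbers, kept apart by
  the constructors \<open>Pro\<close> and \<open>Nom\<close>.\<close>

type_synonym pvar = nat
type_synonym nom = nat

datatype fm =
    Pro pvar
  | Nom nom
  | Neg fm
  | Con fm fm
  | Dis fm fm
  | Dia fm
  | Box fm
  | At nom fm

fun noms :: "fm \<Rightarrow> nom set" where
  "noms (Pro p) = {}"
| "noms (Nom i) = {i}"
| "noms (Neg \<phi>) = noms \<phi>"
| "noms (Con \<phi> \<psi>) = noms \<phi> \<union> noms \<psi>"
| "noms (Dis \<phi> \<psi>) = noms \<phi> \<union> noms \<psi>"
| "noms (Dia \<phi>) = noms \<phi>"
| "noms (Box \<phi>) = noms \<phi>"
| "noms (At i \<phi>) = insert i (noms \<phi>)"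

fun subfms :: "fm \<Rightarrow> fm set" where
  "subfms (Pro p) = {Pro p}"
| "subfms (Nom i) = {Nom i}"
| "subfms (Neg \<phi>) = insert (Neg \<phi>) (subfms \<phi>)"
| "subfms (Con \<phi> \<psi>) = insert (Con \<phi> \<psi>) (subfms \<phi> \<union> subfms \<psi>)"
| "subfms (Dis \<phi> \<psi>) = insert (Dis \<phi> \<psi>) (subfms \<phi> \<union> subfms \<psi>)"
| "subfms (Dia \<phi>) = insert (Dia \<phi>) (subfms \<phi>)"
| "subfms (Box \<phi>) = insert (Box \<phi>) (subfms \<phi>)"
| "subfms (At i \<phi>) = insert (At i \<phi>) (subfms \<phi>)"

text \<open>\<open>nnf \<phi>\<close> is the negation normal form of \<open>\<phi>\<close>, and \<open>neg \<phi>\<close> that of its negation.\<close>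

fun nnf :: "fm \<Rightarrow> fm" and neg :: "fm \<Rightarrow> fm" where
  "nnf (Pro p) = Pro p"
| "nnf (Nom i) = Nom i"
| "nnf (Neg \<phi>) = neg \<phi>"
| "nnf (Con \<phi> \<psi>) = Con (nnf \<phi>) (nnf \<psi>)"
| "nnf (Dis \<phi> \<psi>) = Dis (nnf \<phi>) (nnf \<psi>)"
| "nnf (Dia \<phi>) = Dia (nnf \<phi>)"
| "nnf (Box \<phi>) = Box (nnf \<phi>)"
| "nnf (At i \<phi>) = At i (nnf \<phi>)"
| "neg (Pro p) = Neg (Pro p)"
| "neg (Nom i) = Neg (Nom i)"
| "neg (Neg \<phi>) = nnf \<phi>"
| "neg (Con \<phi> \<psi>) = Dis (neg \<phi>) (neg \<psi>)"
| "neg (Dis \<phi> \<psi>) = Con (neg \<phi>) (neg \<psi>)"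
| "neg (Dia \<phi>) = Box (neg \<phi>)"
| "neg (Box \<phi>) = Dia (neg \<phi>)"
| "neg (At i \<phi>) = At i (neg \<phi>)"


text \<open>The valuation is split in two: \<open>pval p\<close> is the set \<open>V(p)\<close>, and \<open>nval i\<close> is the unique
  element of the singleton \<open>V(i)\<close>.\<close>

record 'w model =
  worlds :: "'w set"
  acc :: "('w \<times> 'w) set"
  pval :: "pvar \<Rightarrow> 'w set"
  nval :: "nom \<Rightarrow> 'w"

definition is_model :: "'w model \<Rightarrow> bool" where
  "is_model M \<longleftrightarrow>
     worlds M \<noteq> {} \<and>
     acc M \<subseteq> worlds M \<times> worlds M \<and>
     (\<forall>p. pval M p \<subseteq> worlds M) \<and>
     (\<forall>i. nval M i \<in> worlds M)"

definition uspo_model :: "'w model \<Rightarrow> bool" where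
  "uspo_model M \<longleftrightarrow>
     is_model M \<and>
     (\<forall>x\<in>worlds M. \<exists>y\<in>worlds M. (x, y) \<in> acc M) \<and>
     irrefl (acc M) \<and>
     trans (acc M)"

fun sat :: "'w model \<Rightarrow> 'w \<Rightarrow> fm \<Rightarrow> bool" where
  "sat M w (Pro p) \<longleftrightarrow> w \<in> pval M p"
| "sat M w (Nom i) \<longleftrightarrow> w = nval M i"
| "sat M w (Neg \<phi>) \<longleftrightarrow> \<not> sat M w \<phi>"
| "sat M w (Con \<phi> \<psi>) \<longleftrightarrow> sat M w \<phi> \<and> sat M w \<psi>"
| "sat M w (Dis \<phi> \<psi>) \<longleftrightarrow> sat M w \<phi> \<or> sat M w \<psi>"
| "sat M w (Dia \<phi>) \<longleftrightarrow> (\<exists>v. (w, v) \<in> acc M \<and> sat M v \<phi>)"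
| "sat M w (Box \<phi>) \<longleftrightarrow> (\<forall>v. (w, v) \<in> acc M \<longrightarrow> sat M v \<phi>)"
| "sat M w (At i \<phi>) \<longleftrightarrow> sat M (nval M i) \<phi>"


text \<open>One step extends a branch by the conclusions of one rule application (on one side, for the
  branching rule). Applications of the diamond rule (to \<open>At i (Dia \<phi>)\<close>, with new nominal \<open>j\<close>) and
  of the seriality rule (to \<open>i\<close>, with new nominal \<open>j\<close>) are recorded as such, because later rule
  applications depend on them. A (finite) branch is given by the root formula \<open>\<rho>\<close> and the list
  \<open>\<Theta>\<close> of steps, oldest first.\<close>

datatype step =
    Plain "fm set"
  | DiaStep nom fm nom
  | SerStep nom nom

fun added :: "step \<Rightarrow> fm set" where
  "added (Plain \<Gamma>) = \<Gamma>"
| "added (DiaStep i \<phi> j) = {At i (Dia (Nom j)), At j \<phi>}"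
| "added (SerStep i j) = {At i (Dia (Nom j))}"

definition fms :: "fm \<Rightarrow> step list \<Rightarrow> fm set" where
  "fms \<rho> \<Theta> = insert \<rho> (\<Union>s\<in>set \<Theta>. added s)"

definition branch_noms :: "fm \<Rightarrow> step list \<Rightarrow> nom set" where
  "branch_noms \<rho> \<Theta> = (\<Union>\<phi>\<in>fms \<rho> \<Theta>. noms \<phi>)"

definition closed :: "fm set \<Rightarrow> bool" where
  "closed B \<longleftrightarrow> (\<exists>i \<phi>. At i \<phi> \<in> B \<and> At i (neg \<phi>) \<in> B)"

text \<open>Accessibility formulas are those produced by the diamond rule only, not those
  produced by the seriality rule.\<close>

definition accessibility_fms :: "step list \<Rightarrow> fm set" where
  "accessibility_fms \<Theta> = {At i (Dia (Nom j)) |i j. \<exists>\<phi>. DiaStep i \<phi> j \<in> set \<Theta>}"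


fun prefixed_subfm :: "fm \<Rightarrow> fm \<Rightarrow> bool" where
  "prefixed_subfm (At i \<phi>) (At j \<psi>) \<longleftrightarrow> \<phi> \<in> subfms \<psi>"
| "prefixed_subfm _ _ \<longleftrightarrow> False"

definition T1 :: "fm \<Rightarrow> step list \<Rightarrow> nom \<Rightarrow> fm set" where
  "T1 \<rho> \<Theta> i = {\<phi>. At i \<phi> \<in> fms \<rho> \<Theta> \<and> prefixed_subfm (At i \<phi>) \<rho>}"

definition T2 :: "fm \<Rightarrow> step list \<Rightarrow> nom \<Rightarrow> fm set" where
  "T2 \<rho> \<Theta> i =
     {\<psi>. At i \<psi> \<in> fms \<rho> \<Theta> \<and>
         (\<exists>j\<in>noms \<rho>. prefixed_subfm (At i \<psi>) (At j (Box (Neg (Nom j)))))}"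

definition twins :: "fm \<Rightarrow> step list \<Rightarrow> nom \<Rightarrow> nom \<Rightarrow> bool" where
  "twins \<rho> \<Theta> i j \<longleftrightarrow>
     i \<in> branch_noms \<rho> \<Theta> \<and> j \<in> branch_noms \<rho> \<Theta> \<and>
     T1 \<rho> \<Theta> i \<union> T2 \<rho> \<Theta> i = T1 \<rho> \<Theta> j \<union> T2 \<rho> \<Theta> j"

definition generates :: "step list \<Rightarrow> (nom \<times> nom) set" where
  "generates \<Theta> = {(i, j). \<exists>\<phi>. DiaStep i \<phi> j \<in> set \<Theta>}"

definition quasi_urfather :: "fm \<Rightarrow> step list \<Rightarrow> nom \<Rightarrow> bool" where
  "quasi_urfather \<rho> \<Theta> i \<longleftrightarrow>
     i \<in> branch_noms \<rho> \<Theta> \<and>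
     \<not> (\<exists>j k. j \<noteq> k \<and> twins \<rho> \<Theta> j k \<and> (j, i) \<in> (generates \<Theta>)\<^sup>* \<and> (k, i) \<in> (generates \<Theta>)\<^sup>*)"


text \<open>\<open>rule \<rho> \<Theta> S\<close>: some rule of the calculus extends the branch \<open>\<Theta>\<close> by the steps in \<open>S\<close>, one
  new branch for each element of \<open>S\<close>.\<close>

inductive rule :: "fm \<Rightarrow> step list \<Rightarrow> step set \<Rightarrow> bool" for \<rho> :: fm and \<Theta> :: "step list" where
  Eq: "i \<in> branch_noms \<rho> \<Theta> \<Longrightarrow> rule \<rho> \<Theta> {Plain {At i (Nom i)}}"
| Con: "At i (Con \<phi> \<psi>) \<in> fms \<rho> \<Theta> \<Longrightarrow> rule \<rho> \<Theta> {Plain {At i \<phi>, At i \<psi>}}"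
| Dis: "At i (Dis \<phi> \<psi>) \<in> fms \<rho> \<Theta> \<Longrightarrow> rule \<rho> \<Theta> {Plain {At i \<phi>}, Plain {At i \<psi>}}"
| Dia: "At i (Dia \<phi>) \<in> fms \<rho> \<Theta> \<Longrightarrow>
    At i (Dia \<phi>) \<notin> accessibility_fms \<Theta> \<Longrightarrow>
    \<nexists>k. DiaStep i \<phi> k \<in> set \<Theta> \<Longrightarrow>
    quasi_urfather \<rho> \<Theta> i \<Longrightarrow>
    j \<notin> branch_noms \<rho> \<Theta> \<Longrightarrow>
    rule \<rho> \<Theta> {DiaStep i \<phi> j}"
| Box: "At i (Box \<phi>) \<in> fms \<rho> \<Theta> \<Longrightarrow> At i (Dia (Nom j)) \<in> fms \<rho> \<Theta> \<Longrightarrow>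
    rule \<rho> \<Theta> {Plain {At j \<phi>}}"
| At: "At i (At j \<phi>) \<in> fms \<rho> \<Theta> \<Longrightarrow> rule \<rho> \<Theta> {Plain {At j \<phi>}}"
| Id: "At i \<phi> \<in> fms \<rho> \<Theta> \<Longrightarrow> At i \<phi> \<notin> accessibility_fms \<Theta> \<Longrightarrow> At i (Nom j) \<in> fms \<rho> \<Theta> \<Longrightarrow>
    rule \<rho> \<Theta> {Plain {At j \<phi>}}"
| Irr: "i \<in> branch_noms \<rho> \<Theta> \<Longrightarrow> rule \<rho> \<Theta> {Plain {At i (Box (Neg (Nom i)))}}"
| Trs: "At i (Box \<phi>) \<in> fms \<rho> \<Theta> \<Longrightarrow> At i (Dia (Nom j)) \<in> fms \<rho> \<Theta> \<Longrightarrow>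
    rule \<rho> \<Theta> {Plain {At j (Box \<phi>)}}"
| Ser: "i \<in> branch_noms \<rho> \<Theta> \<Longrightarrow> \<nexists>k. SerStep i k \<in> set \<Theta> \<Longrightarrow> j \<notin> branch_noms \<rho> \<Theta> \<Longrightarrow>
    rule \<rho> \<Theta> {SerStep i j}"

text \<open>Closed branches are not extended, and each new branch must contain a new formula.\<close>

definition extends_by :: "fm \<Rightarrow> step list \<Rightarrow> step set \<Rightarrow> bool" where
  "extends_by \<rho> \<Theta> S \<longleftrightarrow>
     \<not> closed (fms \<rho> \<Theta>) \<and> rule \<rho> \<Theta> S \<and> (\<forall>s\<in>S. \<not> added s \<subseteq> fms \<rho> \<Theta>)"

text \<open>A tableau is a possibly infinite tree, given as the set of its nodes; a node is identified
  with the list of steps leading to it from the root. The formulas of a complete branch are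
  those of a leaf or those along an infinite path.\<close>

definition tableau :: "fm \<Rightarrow> step list set \<Rightarrow> bool" where
  "tableau \<rho> \<T> \<longleftrightarrow>
     [] \<in> \<T> \<and>
     (\<forall>\<Theta> s. \<Theta> @ [s] \<in> \<T> \<longrightarrow> \<Theta> \<in> \<T>) \<and>
     (\<forall>\<Theta>\<in>\<T>. {s. \<Theta> @ [s] \<in> \<T>} = {} \<or> extends_by \<rho> \<Theta> {s. \<Theta> @ [s] \<in> \<T>})"

definition branches :: "fm \<Rightarrow> step list set \<Rightarrow> fm set set" where
  "branches \<rho> \<T> =
     {fms \<rho> \<Theta> |\<Theta>. \<Theta> \<in> \<T> \<and> (\<forall>s. \<Theta> @ [s] \<notin> \<T>)} \<union>
     {(\<Union>n. fms \<rho> (map f [0..<n])) |f. \<forall>n. map f [0..<n] \<in> \<T>}"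

definition closed_tableau :: "fm \<Rightarrow> step list set \<Rightarrow> bool" where
  "closed_tableau \<rho> \<T> \<longleftrightarrow> tableau \<rho> \<T> \<and> (\<forall>B\<in>branches \<rho> \<T>. closed B)"

definition provable :: "fm \<Rightarrow> bool" where
  "provable \<phi> \<longleftrightarrow> (\<exists>i \<T>. i \<notin> noms \<phi> \<and> closed_tableau (At i (neg \<phi>)) \<T>)"

text \<open>Truth at every world of every USPO model whose worlds are taken from the type \<open>'w\<close>.
  USPO models are infinite, so this is only meaningful for infinite \<open>'w\<close>.\<close>

definition uspo_valid :: "'w itself \<Rightarrow> fm \<Rightarrow> bool" where
  "uspo_valid _ \<phi> \<longleftrightarrow> (\<forall>M :: 'w model. uspo_model M \<longrightarrow> (\<forall>w\<in>worlds M. sat M w \<phi>))"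

end

theory Submission
  imports Defs "HOL-Library.Countable_Set"
begin

text \<open>If the root cannot be closed, then some side of every rule application cannot be closed either,
  so there is an infinite open branch on which every rule that stays applicable is eventually
  applied. The type \<open>T i\<close> of a nominal is the finite set of formulas of the closure (the subformulas
  of the root formula and of \<open>\<box>\<not>j\<close>, \<open>j\<close> in the root) that hold at \<open>i\<close> on the limit branch. The types
  of the limit quasi-urfathers form a finite serial graph: a blocked child is replaced by its
  twin, which has the same type. This graph may have cycles, so a world is a type with a counter,
  and edges inside a cluster increase the counter. Types containing a nominal lie on no cycle by
  \<open>[Irr]\<close>, so they are not duplicated and nominals keep a unique value. The model is countable and
  hence can be copied into any infinite type.\<close>

text \<open>Needed to enumerate the tasks in the schedule of a fair branch.\<close>

instance fm :: countable
  by countable_datatype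

section \<open>Negation normal forms\<close>

fun is_nnf :: "fm \<Rightarrow> bool" where
  "is_nnf (Pro p) \<longleftrightarrow> True"
| "is_nnf (Nom i) \<longleftrightarrow> True"
| "is_nnf (Neg \<phi>) \<longleftrightarrow> (\<exists>p. \<phi> = Pro p) \<or> (\<exists>i. \<phi> = Nom i)"
| "is_nnf (Con \<phi> \<psi>) \<longleftrightarrow> is_nnf \<phi> \<and> is_nnf \<psi>"
| "is_nnf (Dis \<phi> \<psi>) \<longleftrightarrow> is_nnf \<phi> \<and> is_nnf \<psi>"
| "is_nnf (Dia \<phi>) \<longleftrightarrow> is_nnf \<phi>"
| "is_nnf (Box \<phi>) \<longleftrightarrow> is_nnf \<phi>"
| "is_nnf (At i \<phi>) \<longleftrightarrow> is_nnf \<phi>"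

lemma is_nnf_nnf_neg: "is_nnf (nnf \<phi>) \<and> is_nnf (neg \<phi>)"
  by (induction \<phi>) auto

lemma is_nnf_subfms: "is_nnf \<phi> \<Longrightarrow> \<psi> \<in> subfms \<phi> \<Longrightarrow> is_nnf \<psi>"
  by (induction \<phi>) auto

lemma sat_nnf_neg: "(sat M w (nnf \<phi>) \<longleftrightarrow> sat M w \<phi>) \<and> (sat M w (neg \<phi>) \<longleftrightarrow> \<not> sat M w \<phi>)"
  by (induction \<phi> arbitrary: w) auto

lemma finite_noms: "finite (noms \<phi>)"
  by (induction \<phi>) auto

lemma subfms_refl: "\<phi> \<in> subfms \<phi>"
  by (cases \<phi>) auto

lemma subfms_trans: "\<psi> \<in> subfms \<phi> \<Longrightarrow> subfms \<psi> \<subseteq> subfms \<phi>"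
  by (induction \<phi>) auto

lemma finite_subfms: "finite (subfms \<phi>)"
  by (induction \<phi>) auto

lemma noms_subfms: "\<psi> \<in> subfms \<phi> \<Longrightarrow> noms \<psi> \<subseteq> noms \<phi>"
  by (induction \<phi>) auto

section \<open>Transfer of models along injections\<close>

definition image_model :: "('a \<Rightarrow> 'b) \<Rightarrow> 'a model \<Rightarrow> 'b model" where
  "image_model f M =
     \<lparr>worlds = f ` worlds M, acc = map_prod f f ` acc M,
      pval = (\<lambda>p. f ` pval M p), nval = (\<lambda>i. f (nval M i))\<rparr>"

lemma image_model_acc_iff:
  assumes "is_model M" and f: "inj_on f (worlds M)" and w: "w \<in> worlds M"
  shows "(f w, v) \<in> acc (image_model f M) \<longleftrightarrow> (\<exists>u. v = f u \<and> (w, u) \<in> acc M)"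
proof
  assume "(f w, v) \<in> acc (image_model f M)"
  then obtain w' u where "f w = f w'" "v = f u" "(w', u) \<in> acc M"
    by (auto simp: image_model_def)
  moreover from this have "w' = w"
    using assms by (auto simp: is_model_def dest: inj_onD)
  ultimately show "\<exists>u. v = f u \<and> (w, u) \<in> acc M" by blast
qed (force simp: image_model_def)

lemma sat_image_model:
  assumes M: "is_model M" and f: "inj_on f (worlds M)"
  shows "w \<in> worlds M \<Longrightarrow> sat (image_model f M) (f w) \<phi> \<longleftrightarrow> sat M w \<phi>"
proof (induction \<phi> arbitrary: w)
  case (Pro p)
  have "pval M p \<subseteq> worlds M" using M by (auto simp: is_model_def)
  then show ?case
    using Pro f by (simp add: image_model_def inj_on_image_mem_iff)
next
  case (Nom i)
  have "nval M i \<in> worlds M" using M by (auto simp: is_model_def)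
  then show ?case
    using Nom f by (simp add: image_model_def inj_on_eq_iff)
next
  case (Dia \<phi>)
  have "acc M \<subseteq> worlds M \<times> worlds M" using M by (auto simp: is_model_def)
  then show ?case
    using Dia by (auto simp: image_model_acc_iff[OF M f])
next
  case (Box \<phi>)
  have "acc M \<subseteq> worlds M \<times> worlds M" using M by (auto simp: is_model_def)
  then show ?case
    using Box by (auto simp: image_model_acc_iff[OF M f])
next
  case (At i \<phi>)
  have "nval M i \<in> worlds M" using M by (auto simp: is_model_def)
  then have "sat (image_model f M) (f (nval M i)) \<phi> \<longleftrightarrow> sat M (nval M i) \<phi>"
    by (rule At.IH)
  then show ?case by (simp add: image_model_def)
qed auto

lemma uspo_image_model:
  assumes M: "uspo_model M" and f: "inj_on f (worlds M)"
  shows "uspo_model (image_model f M)"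
proof -
  have m: "is_model M" using M by (simp add: uspo_model_def)
  have sub: "acc M \<subseteq> worlds M \<times> worlds M" using m by (simp add: is_model_def)
  have acc: "acc (image_model f M) \<subseteq> worlds (image_model f M) \<times> worlds (image_model f M)"
    using sub by (auto simp: image_model_def)
  have "is_model (image_model f M)"
    using m acc unfolding is_model_def by (simp add: image_model_def image_mono)
  moreover have "\<forall>x\<in>worlds (image_model f M). \<exists>y\<in>worlds (image_model f M). (x, y) \<in> acc (image_model f M)"
  proof
    fix x assume "x \<in> worlds (image_model f M)"
    then obtain w where w: "w \<in> worlds M" "x = f w" by (auto simp: image_model_def)
    then obtain u where "u \<in> worlds M" "(w, u) \<in> acc M"
      using M by (auto simp: uspo_model_def)
    then show "\<exists>y\<in>worlds (image_model f M). (x, y) \<in> acc (image_model f M)"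
      using w by (force simp: image_model_def)
  qed
  moreover have "irrefl (acc (image_model f M))"
  proof (rule irreflI)
    fix x show "(x, x) \<notin> acc (image_model f M)"
    proof
      assume "(x, x) \<in> acc (image_model f M)"
      then obtain w u where "f w = f u" "(w, u) \<in> acc M"
        by (auto simp: image_model_def)
      moreover from this have "w = u" using sub f by (auto dest: inj_onD)
      ultimately show False using M by (auto simp: uspo_model_def irrefl_def)
    qed
  qed
  moreover have "trans (acc (image_model f M))"
  proof (rule transI)
    fix x y z
    assume xy: "(x, y) \<in> acc (image_model f M)" and yz: "(y, z) \<in> acc (image_model f M)"
    from xy obtain w u where w: "x = f w" "y = f u" "(w, u) \<in> acc M"
      by (auto simp: image_model_def)
    then have "u \<in> worlds M" using sub by auto
    then obtain v where "z = f v" "(u, v) \<in> acc M"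
      using yz w(2) image_model_acc_iff[OF m f] by blast
    then have "(w, v) \<in> acc M" "z = f v"
      using M w(3) by (auto simp: uspo_model_def dest: transD)
    then show "(x, z) \<in> acc (image_model f M)"
      using w(1) by (force simp: image_model_def)
  qed
  ultimately show ?thesis by (simp add: uspo_model_def)
qed

text \<open>Validity concerns models over one fixed type, while the countermodel lives over another.
  Numbering its worlds and injecting the numbers into \<open>'w\<close> gives an isomorphic copy
  over \<open>'w\<close>.\<close>

lemma uspo_valid_countable:
  fixes M :: "'a model"
  assumes "infinite (UNIV :: 'w set)" and "uspo_valid TYPE('w) \<phi>"
    and "uspo_model M" and "countable (worlds M)" and "w \<in> worlds M"
  shows "sat M w \<phi>"
proof -
  obtain g :: "nat \<Rightarrow> 'w" where g: "inj g"
    using infinite_countable_subset[OF assms(1)] by auto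
  define f where "f = g \<circ> to_nat_on (worlds M)"
  have f: "inj_on f (worlds M)"
    unfolding f_def using inj_on_to_nat_on[OF assms(4)] g
    by (auto intro: comp_inj_on inj_on_subset)
  have "sat (image_model f M) (f w) \<phi>"
    using assms(2,5) uspo_image_model[OF assms(3) f]
    by (auto simp: uspo_valid_def image_model_def)
  then show ?thesis
    using sat_image_model[OF _ f assms(5)] assms(3) by (simp add: uspo_model_def)
qed

section \<open>Closable branches\<close>

text \<open>As a least fixed point, this unfolds into well-founded trees only, so infinite paths
  never arise. Its negation is the invariant that keeps a branch open.\<close>

inductive closable :: "fm \<Rightarrow> step list \<Rightarrow> bool" for \<rho> where
  closed: "closed (fms \<rho> \<Theta>) \<Longrightarrow> closable \<rho> \<Theta>"
| extend: "extends_by \<rho> \<Theta> S \<Longrightarrow> (\<And>s. s \<in> S \<Longrightarrow> closable \<rho> (\<Theta> @ [s])) \<Longrightarrow> closable \<rho> \<Theta>"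

text \<open>A closed tableau continuing the branch \<open>\<Theta>\<close>; nodes are named by their steps after \<open>\<Theta>\<close>.\<close>

definition closing :: "fm \<Rightarrow> step list \<Rightarrow> step list set \<Rightarrow> bool" where
  "closing \<rho> \<Theta> \<T> \<longleftrightarrow>
     [] \<in> \<T> \<and>
     (\<forall>\<Xi> s. \<Xi> @ [s] \<in> \<T> \<longrightarrow> \<Xi> \<in> \<T>) \<and>
     (\<forall>\<Xi>\<in>\<T>. {s. \<Xi> @ [s] \<in> \<T>} = {} \<and> closed (fms \<rho> (\<Theta> @ \<Xi>)) \<or>
        extends_by \<rho> (\<Theta> @ \<Xi>) {s. \<Xi> @ [s] \<in> \<T>}) \<and>
     (\<nexists>f. \<forall>n. map f [0..<n] \<in> \<T>)"

lemma closing_singleton: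
  assumes "closed (fms \<rho> \<Theta>)"
  shows "closing \<rho> \<Theta> {[]}"
proof -
  have "\<nexists>f :: nat \<Rightarrow> step. \<forall>n. map f [0..<n] \<in> {[]}"
    by (auto intro: exI[of _ 1])
  then show ?thesis using assms by (auto simp: closing_def)
qed

text \<open>Keeps leaves apart from extended nodes: a node without successors cannot arise from a
  rule, so in a closing tree it must be closed.\<close>

lemma rule_nonempty: "rule \<rho> \<Theta> S \<Longrightarrow> S \<noteq> {}"
  by (auto elim: rule.cases)

lemma closing_extend:
  assumes ext: "extends_by \<rho> \<Theta> S" and t: "\<And>s. s \<in> S \<Longrightarrow> closing \<rho> (\<Theta> @ [s]) (t s)"
  shows "closing \<rho> \<Theta> (insert [] (\<Union>s\<in>S. (#) s ` t s))" (is "closing _ _ ?T")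
proof -
  have nil: "[] \<in> t s" if "s \<in> S" for s using t[OF that] by (simp add: closing_def)
  have Cons_iff: "s # \<Xi> \<in> ?T \<longleftrightarrow> s \<in> S \<and> \<Xi> \<in> t s" for s \<Xi> by auto
  have prefix: "\<Xi> \<in> ?T" if "\<Xi> @ [s] \<in> ?T" for \<Xi> s
  proof (cases \<Xi>)
    case (Cons u \<Xi>')
    then have u: "u \<in> S" "\<Xi>' @ [s] \<in> t u" using that Cons_iff by auto
    then have "\<Xi>' \<in> t u" using t[OF u(1)] by (auto simp: closing_def)
    then show ?thesis using u Cons by auto
  qed simp
  have nodes: "{s. \<Xi> @ [s] \<in> ?T} = {} \<and> closed (fms \<rho> (\<Theta> @ \<Xi>)) \<or>
      extends_by \<rho> (\<Theta> @ \<Xi>) {s. \<Xi> @ [s] \<in> ?T}" if "\<Xi> \<in> ?T" for \<Xi>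
  proof (cases \<Xi>)
    case Nil
    then have "{s. \<Xi> @ [s] \<in> ?T} = S" using nil by auto
    then show ?thesis using ext Nil by simp
  next
    case (Cons u \<Xi>')
    then have u: "u \<in> S" "\<Xi>' \<in> t u" using that Cons_iff by auto
    have "{s. \<Xi> @ [s] \<in> ?T} = {s. \<Xi>' @ [s] \<in> t u}"
      using Cons u(1) by auto
    then show ?thesis using t[OF u(1)] u(2) Cons by (simp add: closing_def)
  qed
  have no_path: "\<nexists>f. \<forall>n. map f [0..<n] \<in> ?T"
  proof
    assume "\<exists>f. \<forall>n. map f [0..<n] \<in> ?T"
    then obtain f where f: "map f [0..<n] \<in> ?T" for n by blast
    have shift: "map f [0..<Suc n] = f 0 # map (\<lambda>n. f (Suc n)) [0..<n]" for n
      by (induction n) auto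
    \<comment> \<open>The first step of an infinite path selects a subtree, and the remaining steps
      would form an infinite path inside it.\<close>
    have "f 0 \<in> S \<and> map (\<lambda>n. f (Suc n)) [0..<n] \<in> t (f 0)" for n
      using f[of "Suc n"] unfolding shift Cons_iff .
    then have "f 0 \<in> S" "\<exists>g. \<forall>n. map g [0..<n] \<in> t (f 0)" by blast+
    then show False using t[of "f 0"] unfolding closing_def by blast
  qed
  show ?thesis
    unfolding closing_def using prefix nodes no_path by (intro conjI allI impI ballI) simp_all
qed

lemma closable_closing: "closable \<rho> \<Theta> \<Longrightarrow> \<exists>\<T>. closing \<rho> \<Theta> \<T>"
proof (induction rule: closable.induct)
  case (closed \<Theta>)
  then show ?case using closing_singleton by blast
next
  case (extend \<Theta> S)
  then have "\<forall>s\<in>S. \<exists>\<T>. closing \<rho> (\<Theta> @ [s]) \<T>" by blast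
  then obtain t where "\<forall>s\<in>S. closing \<rho> (\<Theta> @ [s]) (t s)" by metis
  then show ?case using closing_extend[OF extend.hyps(1)] by blast
qed

lemma closable_provable:
  assumes "i \<notin> noms \<phi>" and "closable (At i (neg \<phi>)) []"
  shows "provable \<phi>"
proof -
  obtain \<T> where \<T>: "closing (At i (neg \<phi>)) [] \<T>" using closable_closing assms(2) by blast
  have "closed B" if B: "B \<in> branches (At i (neg \<phi>)) \<T>" for B
  proof -
    obtain \<Theta> where "\<Theta> \<in> \<T>" "\<forall>s. \<Theta> @ [s] \<notin> \<T>" and B: "B = fms (At i (neg \<phi>)) \<Theta>"
      using B \<T> by (auto simp: branches_def closing_def)
    then have "closed (fms (At i (neg \<phi>)) \<Theta>) \<or> extends_by (At i (neg \<phi>)) \<Theta> {}"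
      using \<T> by (auto simp: closing_def)
    then show ?thesis using B rule_nonempty by (auto simp: extends_by_def)
  qed
  moreover have "tableau (At i (neg \<phi>)) \<T>"
    using \<T> by (auto simp: closing_def tableau_def)
  ultimately show ?thesis
    using assms(1) by (auto simp: provable_def closed_tableau_def)
qed

section \<open>Fair branches\<close>

text \<open>A task is a rule application up to the choice of the fresh nominal. For
  \<open>Plain\<close> conclusions the outer list holds the alternatives and each inner list the
  formulas added; lists in place of sets keep the type countable.\<close>

type_synonym task = "fm list list + nom \<times> fm + nom"

fun meets :: "task \<Rightarrow> step set \<Rightarrow> bool" where
  "meets (Inl \<Gamma>s) S \<longleftrightarrow> S = (\<lambda>\<Gamma>. Plain (set \<Gamma>)) ` set \<Gamma>s"
| "meets (Inr (Inl (i, \<phi>))) S \<longleftrightarrow> (\<exists>j. S = {DiaStep i \<phi> j})"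
| "meets (Inr (Inr i)) S \<longleftrightarrow> (\<exists>j. S = {SerStep i j})"

fun new_noms :: "step \<Rightarrow> nom set" where
  "new_noms (Plain \<Gamma>) = {}"
| "new_noms (DiaStep i \<phi> j) = {j}"
| "new_noms (SerStep i j) = {j}"

lemma branch_noms_mono: "set \<Theta> \<subseteq> set \<Theta>' \<Longrightarrow> branch_noms \<rho> \<Theta> \<subseteq> branch_noms \<rho> \<Theta>'"
  by (auto simp: branch_noms_def fms_def)

lemma noms_root_subset: "noms \<rho> \<subseteq> branch_noms \<rho> \<Theta>"
  by (auto simp: branch_noms_def fms_def)

lemma At_in_branch_noms: "At i \<phi> \<in> fms \<rho> \<Theta> \<Longrightarrow> insert i (noms \<phi>) \<subseteq> branch_noms \<rho> \<Theta>"
  by (auto simp: branch_noms_def intro: bexI[of _ "At i \<phi>"])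

lemma new_noms_fresh: "rule \<rho> \<Theta> S \<Longrightarrow> s \<in> S \<Longrightarrow> new_noms s \<inter> branch_noms \<rho> \<Theta> = {}"
  by (auto elim: rule.cases)

lemma new_noms_subset: "new_noms s \<subseteq> (\<Union>\<phi>\<in>added s. noms \<phi>)"
  by (cases s) auto

lemma finite_added: "rule \<rho> \<Theta> S \<Longrightarrow> s \<in> S \<Longrightarrow> finite (added s)"
  by (auto elim: rule.cases)

text \<open>A stage may repeat, so that an inapplicable task can be skipped. Fairness gives every
  task, beyond every bound, a stage that carries it out if it is applicable there. The step taken
  may use another fresh nominal, hence \<open>S'\<close>.\<close>

locale fair_branch =
  fixes r :: nom and \<chi> :: fm and \<Theta> :: "nat \<Rightarrow> step list"
  assumes start: "\<Theta> 0 = []"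
    and step: "\<And>n :: nat. \<Theta> (Suc n) = \<Theta> n \<or>
      (\<exists>S s. rule (At r \<chi>) (\<Theta> n) S \<and> s \<in> S \<and> \<Theta> (Suc n) = \<Theta> n @ [s])"
    and not_closed: "\<And>n. \<not> closed (fms (At r \<chi>) (\<Theta> n))"
    and fair: "\<And>t N. \<exists>n\<ge>N. \<forall>S. extends_by (At r \<chi>) (\<Theta> n) S \<and> meets t S \<longrightarrow>
      (\<exists>S' s. meets t S' \<and> s \<in> S' \<and> \<Theta> (Suc n) = \<Theta> n @ [s])"
    and nnf: "is_nnf \<chi>"

lemma fair_branch_exists:
  assumes open_root: "\<not> closable (At r \<chi>) []" and "is_nnf \<chi>"
  shows "\<exists>\<Theta>. fair_branch r \<chi> \<Theta>"
proof -
  let ?\<rho> = "At r \<chi>"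
  \<comment> \<open>Reading \<open>n\<close> as a pair gives every task infinitely many
    turns.\<close>
  define task :: "nat \<Rightarrow> task" where "task = (\<lambda>n. from_nat (fst (prod_decode n)))"
  define next_ok where "next_ok = (\<lambda>n \<Theta> \<Theta>'.
      (\<Theta>' = \<Theta> \<or> (\<exists>S s. rule ?\<rho> \<Theta> S \<and> s \<in> S \<and> \<Theta>' = \<Theta> @ [s])) \<and>
      (\<forall>S. extends_by ?\<rho> \<Theta> S \<and> meets (task n) S \<longrightarrow>
        (\<exists>S' s. meets (task n) S' \<and> s \<in> S' \<and> \<Theta>' = \<Theta> @ [s])))"
  have "\<exists>\<Theta>. \<forall>n. (\<not> closable ?\<rho> (\<Theta> n) \<and> (n = 0 \<longrightarrow> \<Theta> n = [])) \<and> next_ok n (\<Theta> n) (\<Theta> (Suc n))"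
  proof (rule dependent_nat_choice)
    show "\<exists>\<Theta>. \<not> closable ?\<rho> \<Theta> \<and> (0 = (0::nat) \<longrightarrow> \<Theta> = [])" using open_root by blast
  next
    fix \<Theta> and n :: nat
    assume "\<not> closable ?\<rho> \<Theta> \<and> (n = 0 \<longrightarrow> \<Theta> = [])"
    then have \<Theta>: "\<not> closable ?\<rho> \<Theta>" by blast
    show "\<exists>\<Theta>'. (\<not> closable ?\<rho> \<Theta>' \<and> (Suc n = 0 \<longrightarrow> \<Theta>' = [])) \<and> next_ok n \<Theta> \<Theta>'"
    proof (cases "\<exists>S. extends_by ?\<rho> \<Theta> S \<and> meets (task n) S")
      case True
      then obtain S where S: "extends_by ?\<rho> \<Theta> S" "meets (task n) S" by blast
      \<comment> \<open>If all alternatives were closable, \<open>closable.extend\<close> would make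
        \<open>\<Theta>\<close> closable.\<close>
      then obtain s where "s \<in> S" "\<not> closable ?\<rho> (\<Theta> @ [s])"
        using \<Theta> closable.extend by blast
      moreover have "rule ?\<rho> \<Theta> S" using S(1) by (simp add: extends_by_def)
      ultimately show ?thesis using S(2) unfolding next_ok_def by blast
    next
      case False
      then show ?thesis using \<Theta> unfolding next_ok_def by blast
    qed
  qed
  then obtain \<Theta> where \<Theta>: "\<not> closable ?\<rho> (\<Theta> n)" "\<Theta> 0 = []" "next_ok n (\<Theta> n) (\<Theta> (Suc n))" for n
    by blast
  have "fair_branch r \<chi> \<Theta>"
  proof
    show "\<not> closed (fms ?\<rho> (\<Theta> n))" for n using \<Theta>(1) closable.closed by blast
    show "\<exists>n\<ge>N. \<forall>S. extends_by ?\<rho> (\<Theta> n) S \<and> meets t S \<longrightarrow>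
      (\<exists>S' s. meets t S' \<and> s \<in> S' \<and> \<Theta> (Suc n) = \<Theta> n @ [s])" for t N
    proof -
      \<comment> \<open>The bound \<open>N\<close> is the second component, which places this turn
        of \<open>t\<close> at or after \<open>N\<close>.\<close>
      define n where "n = prod_encode (to_nat t, N)"
      have "task n = t" by (simp add: n_def task_def)
      moreover have "n \<ge> N" by (simp add: n_def le_prod_encode_2)
      ultimately show ?thesis using \<Theta>(3)[of n] unfolding next_ok_def by blast
    qed
    show "\<Theta> (Suc n) = \<Theta> n \<or> (\<exists>S s. rule ?\<rho> (\<Theta> n) S \<and> s \<in> S \<and> \<Theta> (Suc n) = \<Theta> n @ [s])" for n
      using \<Theta>(3)[of n] unfolding next_ok_def by blast
  qed (use \<Theta>(2) assms(2) in auto)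
  then show ?thesis by blast
qed

context fair_branch
begin

abbreviation \<rho> :: fm where "\<rho> \<equiv> At r \<chi>"

definition B :: "fm set" where "B = (\<Union>n. fms \<rho> (\<Theta> n))"

text \<open>All formulas that \<open>T1\<close> and \<open>T2\<close> can collect. The set is
  finite, closed under subformulas, and mentions root nominals only.\<close>

definition C :: "fm set" where
  "C = subfms \<chi> \<union> (\<Union>j\<in>noms \<rho>. subfms (Box (Neg (Nom j))))"

definition T :: "nom \<Rightarrow> fm set" where "T i = {\<psi>\<in>C. At i \<psi> \<in> B}"

definition G :: "(nom \<times> nom) set" where "G = (\<Union>n. generates (\<Theta> n))"

text \<open>The limit counterpart of \<open>quasi_urfather\<close>: types and ancestry are read off
  the whole branch instead of a stage.\<close>

definition Q :: "nom set" where
  "Q = {i\<in>\<Union>n. branch_noms \<rho> (\<Theta> n).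
     \<forall>j k. (j, i) \<in> G\<^sup>* \<longrightarrow> (k, i) \<in> G\<^sup>* \<longrightarrow> T j = T k \<longrightarrow> j = k}"

section \<open>Growth of the stages into the limit branch\<close>

lemma set_mono: "m \<le> n \<Longrightarrow> set (\<Theta> m) \<subseteq> set (\<Theta> n)"
proof (rule lift_Suc_mono_le[where f = "\<lambda>n. set (\<Theta> n)"])
  show "set (\<Theta> n) \<subseteq> set (\<Theta> (Suc n))" for n using step[of n] by auto
qed

lemma fms_mono: "m \<le> n \<Longrightarrow> fms \<rho> (\<Theta> m) \<subseteq> fms \<rho> (\<Theta> n)"
  using set_mono by (fastforce simp: fms_def)

lemma finite_branch_noms: "finite (branch_noms \<rho> (\<Theta> n))"
proof -
  have "finite (fms \<rho> (\<Theta> n))"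
  proof (induction n)
    case (Suc n)
    then show ?case using step[of n] finite_added by (auto simp: fms_def)
  qed (simp add: fms_def start)
  then show ?thesis by (simp add: branch_noms_def finite_noms)
qed

lemma fresh_nom: "\<exists>j. j \<notin> branch_noms \<rho> (\<Theta> n)"
  using finite_branch_noms ex_new_if_finite infinite_UNIV_nat by blast

lemma B_stage:
  assumes "\<phi> \<in> B"
  shows "\<exists>N. \<forall>n\<ge>N. \<phi> \<in> fms \<rho> (\<Theta> n)"
proof -
  obtain N where "\<phi> \<in> fms \<rho> (\<Theta> N)" using assms by (auto simp: B_def)
  then have "\<forall>n\<ge>N. \<phi> \<in> fms \<rho> (\<Theta> n)" using fms_mono by blast
  then show ?thesis ..
qed

lemma branch_noms_stage:
  "i \<in> branch_noms \<rho> (\<Theta> m) \<Longrightarrow> m \<le> n \<Longrightarrow> i \<in> branch_noms \<rho> (\<Theta> n)"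
  using branch_noms_mono[OF set_mono] by blast

lemma B_open: "At i \<phi> \<in> B \<Longrightarrow> At i (neg \<phi>) \<notin> B"
proof
  assume "At i \<phi> \<in> B" "At i (neg \<phi>) \<in> B"
  then obtain M N where "\<forall>n\<ge>M. At i \<phi> \<in> fms \<rho> (\<Theta> n)" "\<forall>n\<ge>N. At i (neg \<phi>) \<in> fms \<rho> (\<Theta> n)"
    using B_stage by meson
  then have "At i \<phi> \<in> fms \<rho> (\<Theta> (max M N))" "At i (neg \<phi>) \<in> fms \<rho> (\<Theta> (max M N))"
    by simp_all
  then have "closed (fms \<rho> (\<Theta> (max M N)))" unfolding closed_def by blast
  then show False using not_closed by blast
qed

subsection \<open>Saturation\<close>

text \<open>Every stage lies inside \<open>B\<close>. If no alternative did, the rule would add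
  something new at each late stage, and fairness would then put one alternative into
  \<open>B\<close> after all.\<close>

lemma plain_saturated:
  assumes rule: "\<And>n. n \<ge> N \<Longrightarrow> rule \<rho> (\<Theta> n) ((\<lambda>\<Gamma>. Plain (set \<Gamma>)) ` set \<Gamma>s)"
  shows "\<exists>\<Gamma>\<in>set \<Gamma>s. set \<Gamma> \<subseteq> B"
proof (rule ccontr)
  assume no: "\<not> (\<exists>\<Gamma>\<in>set \<Gamma>s. set \<Gamma> \<subseteq> B)"
  obtain n where n: "n \<ge> N" and fair: "\<forall>S. extends_by \<rho> (\<Theta> n) S \<and> meets (Inl \<Gamma>s) S \<longrightarrow>
      (\<exists>S' s. meets (Inl \<Gamma>s) S' \<and> s \<in> S' \<and> \<Theta> (Suc n) = \<Theta> n @ [s])"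
    using fair by blast
  have "extends_by \<rho> (\<Theta> n) ((\<lambda>\<Gamma>. Plain (set \<Gamma>)) ` set \<Gamma>s)"
    unfolding extends_by_def
  proof (intro conjI ballI)
    fix s assume "s \<in> (\<lambda>\<Gamma>. Plain (set \<Gamma>)) ` set \<Gamma>s"
    then obtain \<Gamma> where \<Gamma>: "\<Gamma> \<in> set \<Gamma>s" "s = Plain (set \<Gamma>)" by blast
    have "fms \<rho> (\<Theta> n) \<subseteq> B" by (auto simp: B_def)
    then have "\<not> set \<Gamma> \<subseteq> fms \<rho> (\<Theta> n)" using no \<Gamma>(1) by (meson subset_trans)
    then show "\<not> added s \<subseteq> fms \<rho> (\<Theta> n)" using \<Gamma>(2) by simp
  qed (use rule[OF n] not_closed in blast)+
  then have "\<exists>S' s. meets (Inl \<Gamma>s) S' \<and> s \<in> S' \<and> \<Theta> (Suc n) = \<Theta> n @ [s]"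
    using fair by simp
  then obtain \<Gamma> where \<Gamma>: "\<Gamma> \<in> set \<Gamma>s" "\<Theta> (Suc n) = \<Theta> n @ [Plain (set \<Gamma>)]" by auto
  then have "set \<Gamma> \<subseteq> fms \<rho> (\<Theta> (Suc n))" by (auto simp: fms_def)
  then have "set \<Gamma> \<subseteq> B" by (auto simp: B_def)
  then show False using no \<Gamma>(1) by blast
qed

lemma B_Eq:
  assumes "i \<in> branch_noms \<rho> (\<Theta> m)"
  shows "At i (Nom i) \<in> B"
  using plain_saturated[of m "[[At i (Nom i)]]"] rule.Eq branch_noms_stage[OF assms] by auto

lemma B_Irr:
  assumes "i \<in> branch_noms \<rho> (\<Theta> m)"
  shows "At i (Box (Neg (Nom i))) \<in> B"
  using plain_saturated[of m "[[At i (Box (Neg (Nom i)))]]"] rule.Irr branch_noms_stage[OF assms]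
  by auto

lemma B_Con:
  assumes "At i (Con \<phi> \<psi>) \<in> B"
  shows "At i \<phi> \<in> B" "At i \<psi> \<in> B"
proof -
  obtain N where "\<forall>n\<ge>N. At i (Con \<phi> \<psi>) \<in> fms \<rho> (\<Theta> n)" using B_stage assms by blast
  then show "At i \<phi> \<in> B" "At i \<psi> \<in> B"
    using plain_saturated[of N "[[At i \<phi>, At i \<psi>]]"] rule.Con by auto
qed

lemma B_Dis:
  assumes "At i (Dis \<phi> \<psi>) \<in> B"
  shows "At i \<phi> \<in> B \<or> At i \<psi> \<in> B"
proof -
  obtain N where "\<forall>n\<ge>N. At i (Dis \<phi> \<psi>) \<in> fms \<rho> (\<Theta> n)" using B_stage assms by blast
  then show ?thesis
    using plain_saturated[of N "[[At i \<phi>], [At i \<psi>]]"] rule.Dis by auto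
qed

lemma B_At:
  assumes "At i (At j \<phi>) \<in> B"
  shows "At j \<phi> \<in> B"
proof -
  obtain N where "\<forall>n\<ge>N. At i (At j \<phi>) \<in> fms \<rho> (\<Theta> n)" using B_stage assms by blast
  then show ?thesis
    using plain_saturated[of N "[[At j \<phi>]]"] rule.At[of i j \<phi>] by auto
qed

lemma B_Box:
  assumes "At i (Box \<phi>) \<in> B" "At i (Dia (Nom j)) \<in> B"
  shows "At j \<phi> \<in> B" "At j (Box \<phi>) \<in> B"
proof -
  obtain M where M: "\<forall>n\<ge>M. At i (Box \<phi>) \<in> fms \<rho> (\<Theta> n)" using B_stage assms(1) by blast
  obtain N where N: "\<forall>n\<ge>N. At i (Dia (Nom j)) \<in> fms \<rho> (\<Theta> n)" using B_stage assms(2) by blast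
  show "At j \<phi> \<in> B"
    using plain_saturated[of "max M N" "[[At j \<phi>]]"] rule.Box[of i \<phi>] M N by auto
  show "At j (Box \<phi>) \<in> B"
    using plain_saturated[of "max M N" "[[At j (Box \<phi>)]]"] rule.Trs[of i \<phi>] M N by auto
qed

section \<open>Origin of the fresh nominals\<close>

lemma step_introduced:
  "s \<in> set (\<Theta> m) \<Longrightarrow> \<exists>p<m. \<Theta> (Suc p) = \<Theta> p @ [s] \<and> (\<exists>S. rule \<rho> (\<Theta> p) S \<and> s \<in> S)"
proof (induction m)
  case 0
  then show ?case by (simp add: start)
next
  case (Suc m)
  show ?case
  proof (cases "s \<in> set (\<Theta> m)")
    case True
    then show ?thesis using Suc.IH less_Suc_eq by blast
  next
    case False
    then show ?thesis using step[of m] Suc.prems by (auto intro!: exI[of _ m])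
  qed
qed

lemma new_nom_in_branch: "s \<in> set (\<Theta> n) \<Longrightarrow> j \<in> new_noms s \<Longrightarrow> j \<in> branch_noms \<rho> (\<Theta> n)"
  using new_noms_subset[of s] by (fastforce simp: branch_noms_def fms_def)

text \<open>The nominal is fresh when \<open>s\<close> is applied, so any stage that mentions it
  comes after that application.\<close>

lemma new_nom_stage:
  assumes "s \<in> set (\<Theta> m)" "j \<in> new_noms s" "j \<in> branch_noms \<rho> (\<Theta> n)"
  shows "s \<in> set (\<Theta> n)"
proof -
  obtain p S where p: "\<Theta> (Suc p) = \<Theta> p @ [s]" "rule \<rho> (\<Theta> p) S" "s \<in> S"
    using step_introduced[OF assms(1)] by blast
  then have "j \<notin> branch_noms \<rho> (\<Theta> p)" using new_noms_fresh assms(2) by blast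
  then have "Suc p \<le> n" using branch_noms_stage assms(3) not_less_eq_eq by blast
  then show ?thesis using set_mono p(1) by fastforce
qed

text \<open>Right after \<open>s\<close> the nominal is present, hence so is \<open>s'\<close>; just
  before, it was fresh, hence \<open>s'\<close> was absent. So both are the last step.\<close>

lemma new_nom_unique:
  assumes "s \<in> set (\<Theta> m)" "j \<in> new_noms s" "s' \<in> set (\<Theta> n)" "j \<in> new_noms s'"
  shows "s = s'"
proof -
  obtain p S where p: "\<Theta> (Suc p) = \<Theta> p @ [s]" "rule \<rho> (\<Theta> p) S" "s \<in> S"
    using step_introduced[OF assms(1)] by blast
  have "j \<in> branch_noms \<rho> (\<Theta> (Suc p))" using new_nom_in_branch[of s "Suc p" j] p(1) assms(2) by simp
  then have "s' \<in> set (\<Theta> (Suc p))" using new_nom_stage assms(3,4) by blast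
  moreover have "s' \<notin> set (\<Theta> p)"
    using new_nom_in_branch assms(2,4) new_noms_fresh[OF p(2,3)] by blast
  ultimately show ?thesis using p(1) by auto
qed

lemma new_nom_not_root:
  assumes "s \<in> set (\<Theta> m)" "j \<in> new_noms s"
  shows "j \<notin> noms \<rho>"
  using new_nom_stage[OF assms, of 0] noms_root_subset[of \<rho> "[]"] start by auto

section \<open>The finite closure and its types\<close>

lemma finite_C: "finite C"
  unfolding C_def by (intro finite_UnI finite_UN_I finite_subfms finite_noms)

lemma noms_C: "\<psi> \<in> C \<Longrightarrow> noms \<psi> \<subseteq> noms \<rho>"
  using noms_subfms[of \<psi> \<chi>] by (auto simp: C_def)

lemma subfms_C: "\<psi> \<in> C \<Longrightarrow> subfms \<psi> \<subseteq> C"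
  using subfms_trans unfolding C_def by blast

lemma nnf_C: "\<psi> \<in> C \<Longrightarrow> is_nnf \<psi>"
  using is_nnf_subfms nnf by (auto simp: C_def)

text \<open>Discharges the side conditions of \<open>rule.Dia\<close> and \<open>rule.Id\<close>: an
  accessibility formula ends in a nominal foreign to the root, and \<open>C\<close> has no such
  nominals.\<close>

lemma C_not_accessibility:
  assumes "\<psi> \<in> C"
  shows "At i \<psi> \<notin> accessibility_fms (\<Theta> n)"
proof
  assume "At i \<psi> \<in> accessibility_fms (\<Theta> n)"
  then obtain \<phi> j where "\<psi> = Dia (Nom j)" "DiaStep i \<phi> j \<in> set (\<Theta> n)"
    by (auto simp: accessibility_fms_def)
  then show False using noms_C[OF assms] new_nom_not_root[of "DiaStep i \<phi> j" n j] by auto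
qed

lemma B_Id:
  assumes "\<psi> \<in> C" "At i \<psi> \<in> B" "At i (Nom j) \<in> B"
  shows "At j \<psi> \<in> B"
proof -
  obtain M where M: "\<forall>n\<ge>M. At i \<psi> \<in> fms \<rho> (\<Theta> n)" using B_stage assms(2) by blast
  obtain N where N: "\<forall>n\<ge>N. At i (Nom j) \<in> fms \<rho> (\<Theta> n)" using B_stage assms(3) by blast
  show ?thesis
    using plain_saturated[of "max M N" "[[At j \<psi>]]"] rule.Id[of i \<psi>] C_not_accessibility[OF assms(1)]
      M N by auto
qed

text \<open>Applying \<open>rule.Id\<close> to \<open>At i (Nom i)\<close> reverses the equality to
  \<open>At a (Nom i)\<close>, after which \<open>B_Id\<close> copies formulas of \<open>C\<close>
  in both directions.\<close>

lemma T_eqI: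
  assumes "Nom a \<in> T i"
  shows "T i = T a"
proof -
  have a: "Nom a \<in> C" "At i (Nom a) \<in> B" using assms by (auto simp: T_def)
  then have "i \<in> branch_noms \<rho> (\<Theta> n)" if "At i (Nom a) \<in> fms \<rho> (\<Theta> n)" for n
    using At_in_branch_noms[OF that] by simp
  then have refl: "At i (Nom i) \<in> B" using a B_Eq by (auto simp: B_def)
  obtain N where "\<forall>n\<ge>N. At i (Nom a) \<in> fms \<rho> (\<Theta> n)" using B_stage a by blast
  moreover obtain M where "\<forall>n\<ge>M. At i (Nom i) \<in> fms \<rho> (\<Theta> n)" using B_stage refl by blast
  ultimately have "At a (Nom i) \<in> B"
    using plain_saturated[of "max M N" "[[At a (Nom i)]]"] rule.Id[of i "Nom i"]
    by (auto simp: accessibility_fms_def)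
  then show ?thesis using a B_Id by (auto simp: T_def)
qed

subsection \<open>Quasi-urfathers in the limit\<close>

text \<open>The step that introduces a nominal is present whenever the nominal is, so no ancestors
  are gained after a nominal appears.\<close>

lemma generates_ancestors:
  assumes i: "i \<in> branch_noms \<rho> (\<Theta> n)" and "(j, i) \<in> G\<^sup>*"
  shows "(j, i) \<in> (generates (\<Theta> n))\<^sup>* \<and> j \<in> branch_noms \<rho> (\<Theta> n)"
  using assms(2)
proof (induction rule: converse_rtrancl_induct)
  case base
  then show ?case using i by simp
next
  case (step j k)
  then obtain \<phi> m where m: "DiaStep j \<phi> k \<in> set (\<Theta> m)" by (auto simp: G_def generates_def)
  then have s: "DiaStep j \<phi> k \<in> set (\<Theta> n)" using new_nom_stage step.IH by auto
  then have "(j, k) \<in> generates (\<Theta> n)" by (auto simp: generates_def)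
  moreover have "j \<in> branch_noms \<rho> (\<Theta> n)"
    using At_in_branch_noms[of j "Dia (Nom k)"] s by (force simp: fms_def)
  ultimately show ?case using step.IH by auto
qed

lemma finite_ancestors:
  assumes "i \<in> branch_noms \<rho> (\<Theta> n)"
  shows "finite {j. (j, i) \<in> G\<^sup>*}"
  using generates_ancestors[OF assms] by (auto intro: finite_subset[OF _ finite_branch_noms[of n]])

lemma T1_T2_eq: "T1 \<rho> (\<Theta> n) i \<union> T2 \<rho> (\<Theta> n) i = {\<psi>\<in>C. At i \<psi> \<in> fms \<rho> (\<Theta> n)}"
  unfolding T1_def T2_def C_def by (auto simp del: noms.simps)

text \<open>Types are subsets of the finite set \<open>C\<close>, so finitely many formulas have to
  arrive.\<close>

lemma T_stage: "\<exists>N. \<forall>n\<ge>N. T i = {\<psi>\<in>C. At i \<psi> \<in> fms \<rho> (\<Theta> n)}"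
proof -
  have "finite (T i)" using finite_C by (simp add: T_def)
  have "\<forall>\<psi>\<in>T i. \<exists>N. \<forall>n\<ge>N. At i \<psi> \<in> fms \<rho> (\<Theta> n)" using B_stage by (auto simp: T_def)
  then obtain N where N: "\<forall>\<psi>\<in>T i. \<forall>n\<ge>N \<psi>. At i \<psi> \<in> fms \<rho> (\<Theta> n)" by metis
  define M where "M = Max (N ` T i)"
  have "N \<psi> \<le> M" if "\<psi> \<in> T i" for \<psi>
    unfolding M_def using \<open>finite (T i)\<close> that by auto
  then have "At i \<psi> \<in> fms \<rho> (\<Theta> n)" if "\<psi> \<in> T i" "n \<ge> M" for n \<psi>
    using N that order_trans by blast
  moreover have "fms \<rho> (\<Theta> n) \<subseteq> B" for n by (auto simp: B_def)
  ultimately have "T i = {\<psi>\<in>C. At i \<psi> \<in> fms \<rho> (\<Theta> n)}" if "n \<ge> M" for n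
    using that unfolding T_def by blast
  then show ?thesis by blast
qed

text \<open>Restriction (D) is tested at the moment of application, so the limit notion must hold at
  all late stages. The ancestors of \<open>i\<close> are finitely many; once their types have
  settled, twins among them would have equal limit types.\<close>

lemma Q_quasi_urfather:
  assumes "i \<in> Q"
  shows "\<exists>N. \<forall>n\<ge>N. quasi_urfather \<rho> (\<Theta> n) i"
proof -
  obtain m where m: "i \<in> branch_noms \<rho> (\<Theta> m)" using assms by (auto simp: Q_def)
  let ?A = "{j. (j, i) \<in> G\<^sup>*}"
  obtain N where N: "\<forall>j. \<forall>n\<ge>N j. T j = {\<psi>\<in>C. At j \<psi> \<in> fms \<rho> (\<Theta> n)}"
    using T_stage by metis
  define M where "M = Max (insert m (N ` ?A))"
  have fin: "finite (insert m (N ` ?A))" using finite_ancestors[OF m] by simp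
  have M: "m \<le> M" "N j \<le> M" if "(j, i) \<in> G\<^sup>*" for j
    unfolding M_def using that by (auto intro!: Max_ge[OF fin])
  have "quasi_urfather \<rho> (\<Theta> n) i" if n: "n \<ge> M" for n
    unfolding quasi_urfather_def
  proof (intro conjI notI)
    show "i \<in> branch_noms \<rho> (\<Theta> n)" using branch_noms_stage[OF m] M(1)[of i] n by simp
  next
    assume "\<exists>j k. j \<noteq> k \<and> twins \<rho> (\<Theta> n) j k \<and> (j, i) \<in> (generates (\<Theta> n))\<^sup>* \<and>
      (k, i) \<in> (generates (\<Theta> n))\<^sup>*"
    then obtain j k where jk: "j \<noteq> k" "twins \<rho> (\<Theta> n) j k"
      "(j, i) \<in> (generates (\<Theta> n))\<^sup>*" "(k, i) \<in> (generates (\<Theta> n))\<^sup>*" by blast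
    have "generates (\<Theta> n) \<subseteq> G" by (auto simp: G_def)
    then have G: "(j, i) \<in> G\<^sup>*" "(k, i) \<in> G\<^sup>*" using jk(3,4) rtrancl_mono by blast+
    then have "T j = T k"
      using jk(2) N M(2) n unfolding twins_def T1_T2_eq by (metis (no_types, lifting) order_trans)
    then show False using assms G jk(1) by (auto simp: Q_def)
  qed
  then show ?thesis by blast
qed

text \<open>With itself as only ancestor a nominal cannot be blocked. This covers root nominals and
  those from \<open>SerStep\<close>, which does not contribute to \<open>G\<close>.\<close>

lemma Q_I_parentless:
  assumes "i \<in> branch_noms \<rho> (\<Theta> n)" and "\<And>k. (k, i) \<notin> G"
  shows "i \<in> Q"
proof -
  have "j = i" if "(j, i) \<in> G\<^sup>*" for j
    using that assms(2) by (meson rtranclE)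
  then show ?thesis using assms(1) by (auto simp: Q_def)
qed

lemma root_noms_Q: "i \<in> noms \<rho> \<Longrightarrow> i \<in> Q"
proof (rule Q_I_parentless)
  assume i: "i \<in> noms \<rho>"
  then show "i \<in> branch_noms \<rho> (\<Theta> 0)" using noms_root_subset by blast
  show "(k, i) \<notin> G" for k
    using i new_nom_not_root by (fastforce simp: G_def generates_def)
qed

lemma Q_ancestor:
  assumes i: "i \<in> Q" and ji: "(j, i) \<in> G\<^sup>*"
  shows "j \<in> Q"
proof -
  have "j \<in> (\<Union>n. branch_noms \<rho> (\<Theta> n))" using i generates_ancestors ji unfolding Q_def by blast
  then show ?thesis using i rtrancl_trans[OF _ ji] unfolding Q_def by blast
qed

text \<open>A blocked child of a quasi-urfather is a twin of one of its ancestors, which are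
  quasi-urfathers again.\<close>

lemma Q_child:
  assumes i: "i \<in> Q" and s: "DiaStep i \<phi> k \<in> set (\<Theta> n)"
  shows "\<exists>k'\<in>Q. T k' = T k"
proof (cases "k \<in> Q")
  case False
  \<comment> \<open>The parent of \<open>k\<close> is unique, so its proper ancestors are ancestors
    of \<open>i\<close>.\<close>
  have anc: "j = k \<or> (j, i) \<in> G\<^sup>*" if "(j, k) \<in> G\<^sup>*" for j
    using that
  proof (cases rule: rtranclE)
    case (step i')
    then obtain \<phi>' m where "DiaStep i' \<phi>' k \<in> set (\<Theta> m)" by (auto simp: G_def generates_def)
    then have "i' = i" using new_nom_unique[OF _ _ s, of "DiaStep i' \<phi>' k" m k] by simp
    then show ?thesis using step by blast
  qed simp
  have "k \<in> branch_noms \<rho> (\<Theta> n)" using new_nom_in_branch s by auto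
  then obtain j l where "(j, k) \<in> G\<^sup>*" "(l, k) \<in> G\<^sup>*" "T j = T l" "j \<noteq> l"
    using False by (auto simp: Q_def)
  \<comment> \<open>Ancestors of \<open>i\<close> have distinct types, so one of the two twins is
    \<open>k\<close> and the other is an ancestor of \<open>i\<close>.\<close>
  moreover have "\<not> ((j, i) \<in> G\<^sup>* \<and> (l, i) \<in> G\<^sup>*)"
    using i calculation(3,4) by (auto simp: Q_def)
  ultimately show ?thesis using anc Q_ancestor[OF i] by metis
qed auto

text \<open>Two nominals appear because the accessibility formula leads to the child
  \<open>k\<close>, which may be blocked, while \<open>k'\<close> supplies its type within
  \<open>Q\<close>.\<close>

lemma Q_Dia:
  assumes i: "i \<in> Q" and \<phi>: "Dia \<phi> \<in> T i"
  shows "\<exists>k. At i (Dia (Nom k)) \<in> B \<and> At k \<phi> \<in> B \<and> (\<exists>k'\<in>Q. T k' = T k)"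
proof -
  obtain k m where s: "DiaStep i \<phi> k \<in> set (\<Theta> m)"
  proof (rule ccontr)
    assume "\<not> thesis"
    then have no: "DiaStep i \<phi> k \<notin> set (\<Theta> m)" for k m using that by blast
    obtain M where M: "\<forall>n\<ge>M. quasi_urfather \<rho> (\<Theta> n) i" using Q_quasi_urfather i by blast
    obtain N where N: "\<forall>n\<ge>N. At i (Dia \<phi>) \<in> fms \<rho> (\<Theta> n)"
      using B_stage \<phi> by (auto simp: T_def)
    obtain n where n: "n \<ge> max M N" and
      fair: "\<forall>S. extends_by \<rho> (\<Theta> n) S \<and> meets (Inr (Inl (i, \<phi>))) S \<longrightarrow>
        (\<exists>S' s. meets (Inr (Inl (i, \<phi>))) S' \<and> s \<in> S' \<and> \<Theta> (Suc n) = \<Theta> n @ [s])"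
      using fair by blast
    \<comment> \<open>This \<open>j\<close> only shows that the rule is applicable; the branch may
      choose another nominal.\<close>
    obtain j where j: "j \<notin> branch_noms \<rho> (\<Theta> n)" using fresh_nom by blast
    have "rule \<rho> (\<Theta> n) {DiaStep i \<phi> j}"
      using n M N no j C_not_accessibility[of "Dia \<phi>" i n] \<phi>
      by (intro rule.Dia) (auto simp: T_def)
    moreover have "\<not> added (DiaStep i \<phi> j) \<subseteq> fms \<rho> (\<Theta> n)"
      using At_in_branch_noms[of i "Dia (Nom j)" \<rho> "\<Theta> n"] j by auto
    ultimately have "extends_by \<rho> (\<Theta> n) {DiaStep i \<phi> j}"
      using not_closed by (simp add: extends_by_def)
    then obtain k where "\<Theta> (Suc n) = \<Theta> n @ [DiaStep i \<phi> k]" using fair by fastforce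
    then show False using no[of k "Suc n"] by simp
  qed
  then have "At i (Dia (Nom k)) \<in> B" "At k \<phi> \<in> B" by (force simp: B_def fms_def)+
  then show ?thesis using Q_child[OF i s] by blast
qed

lemma Q_Ser:
  assumes i: "i \<in> Q"
  shows "\<exists>k\<in>Q. At i (Dia (Nom k)) \<in> B"
proof -
  obtain k m where s: "SerStep i k \<in> set (\<Theta> m)"
  proof (rule ccontr)
    assume "\<not> thesis"
    then have no: "SerStep i k \<notin> set (\<Theta> m)" for k m using that by blast
    obtain N where N: "i \<in> branch_noms \<rho> (\<Theta> N)" using i by (auto simp: Q_def)
    obtain n where n: "n \<ge> N" and
      fair: "\<forall>S. extends_by \<rho> (\<Theta> n) S \<and> meets (Inr (Inr i)) S \<longrightarrow>
        (\<exists>S' s. meets (Inr (Inr i)) S' \<and> s \<in> S' \<and> \<Theta> (Suc n) = \<Theta> n @ [s])"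
      using fair by blast
    obtain j where j: "j \<notin> branch_noms \<rho> (\<Theta> n)" using fresh_nom by blast
    have "rule \<rho> (\<Theta> n) {SerStep i j}"
      using branch_noms_stage[OF N n] no j by (intro rule.Ser) auto
    moreover have "\<not> added (SerStep i j) \<subseteq> fms \<rho> (\<Theta> n)"
      using At_in_branch_noms[of i "Dia (Nom j)" \<rho> "\<Theta> n"] j by auto
    ultimately have "extends_by \<rho> (\<Theta> n) {SerStep i j}"
      using not_closed by (simp add: extends_by_def)
    then obtain k where "\<Theta> (Suc n) = \<Theta> n @ [SerStep i k]" using fair by fastforce
    then show False using no[of k "Suc n"] by simp
  qed
  have "k \<in> Q"
  proof (rule Q_I_parentless)
    show "k \<in> branch_noms \<rho> (\<Theta> m)" using new_nom_in_branch s by auto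
    show "(j, k) \<notin> G" for j
      using new_nom_unique[OF s] by (fastforce simp: G_def generates_def)
  qed
  moreover have "At i (Dia (Nom k)) \<in> B" using s by (force simp: B_def fms_def)
  ultimately show ?thesis by blast
qed

subsection \<open>The countermodel\<close>

definition W :: "fm set set" where "W = T ` Q"

text \<open>The target need only share its type with a member of \<open>Q\<close>; this redirects
  edges from a blocked child to its twin.\<close>

definition E :: "(fm set \<times> fm set) set" where
  "E = {(T i, T k) |i k. i \<in> Q \<and> T k \<in> W \<and> At i (Dia (Nom k)) \<in> B}"

text \<open>Cycles of \<open>E\<close> are unrolled: inside a cluster, every edge increases the counter.\<close>

definition M :: "(fm set \<times> nat) model" where
  "M = \<lparr>worlds = {(X, n). X \<in> W \<and> (n = 0 \<or> (X, X) \<in> E\<^sup>+)},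
        acc = {((X, m), (Y, n)). X \<in> W \<and> (m = 0 \<or> (X, X) \<in> E\<^sup>+) \<and> Y \<in> W \<and> (n = 0 \<or> (Y, Y) \<in> E\<^sup>+) \<and>
                 (X, Y) \<in> E\<^sup>+ \<and> ((Y, X) \<in> E\<^sup>+ \<longrightarrow> m < n)},
        pval = (\<lambda>p. {(X, n). Pro p \<in> X \<and> X \<in> W \<and> (n = 0 \<or> (X, X) \<in> E\<^sup>+)}),
        nval = (\<lambda>i. (T (if i \<in> noms \<rho> then i else r), 0))\<rparr>"

lemma T_root_W: "a \<in> noms \<rho> \<Longrightarrow> T a \<in> W"
  using root_noms_Q by (simp add: W_def)

lemma E_W: "(X, Y) \<in> E\<^sup>+ \<Longrightarrow> X \<in> W \<and> Y \<in> W"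
  by (induction rule: trancl_induct) (auto simp: E_def W_def)

text \<open>On a single edge the rules \<open>Box\<close> and \<open>Trs\<close> act at the actual
  child \<open>k\<close>; redirection preserves its type. Carrying the box along makes the induction
  over paths work.\<close>

lemma E_Box:
  assumes "(X, Y) \<in> E\<^sup>+" "Box \<phi> \<in> X"
  shows "\<phi> \<in> Y \<and> Box \<phi> \<in> Y"
proof -
  have edge: "\<phi> \<in> Y \<and> Box \<phi> \<in> Y" if "(X, Y) \<in> E" "Box \<phi> \<in> X" for X Y
  proof -
    obtain i k where ik: "X = T i" "Y = T k" "At i (Dia (Nom k)) \<in> B"
      using \<open>(X, Y) \<in> E\<close> by (auto simp: E_def)
    then have "Box \<phi> \<in> C" "At i (Box \<phi>) \<in> B" using \<open>Box \<phi> \<in> X\<close> by (auto simp: T_def)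
    moreover from this have "\<phi> \<in> C" using subfms_C subfms_refl by fastforce
    ultimately show ?thesis using B_Box[of i \<phi> k] ik by (auto simp: T_def)
  qed
  show ?thesis using assms by (induction rule: trancl_induct) (auto dest: edge)
qed

lemma root_nom_C: "a \<in> noms \<rho> \<Longrightarrow> Nom a \<in> C \<and> Box (Neg (Nom a)) \<in> C"
  by (auto simp: C_def)

lemma root_nom_T: "a \<in> noms \<rho> \<Longrightarrow> Nom a \<in> T a"
  using B_Eq noms_root_subset root_nom_C unfolding T_def by blast

lemma W_consistent: "X \<in> W \<Longrightarrow> Nom a \<in> X \<Longrightarrow> Neg (Nom a) \<notin> X"
  using B_open[of _ "Nom a"] by (auto simp: W_def T_def)

lemma W_consistent_Pro: "X \<in> W \<Longrightarrow> Pro p \<in> X \<Longrightarrow> Neg (Pro p) \<notin> X"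
  using B_open[of _ "Pro p"] by (auto simp: W_def T_def)

text \<open>\<open>[Irr]\<close> puts \<open>\<box>\<not>a\<close> into the type of \<open>a\<close>, and types propagate boxes along \<open>E\<close> even through
  redirected edges; hence named worlds are not duplicated.\<close>

lemma named_acyclic:
  assumes "a \<in> noms \<rho>"
  shows "(T a, T a) \<notin> E\<^sup>+"
proof
  assume cyc: "(T a, T a) \<in> E\<^sup>+"
  have "Box (Neg (Nom a)) \<in> T a"
    using B_Irr noms_root_subset root_nom_C assms unfolding T_def by blast
  then have "Neg (Nom a) \<in> T a" using E_Box[OF cyc] by blast
  then show False using W_consistent root_nom_T T_root_W assms by blast
qed

text \<open>If \<open>Y\<close> leads back to \<open>X\<close>, it lies on a cycle and has a copy
  with counter \<open>Suc n\<close>. Otherwise the counters are unconstrained and copy 0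
  serves.\<close>

lemma acc_successor:
  assumes w: "(X, n) \<in> worlds M" and XY: "(X, Y) \<in> E"
  shows "\<exists>m. (Y, m) \<in> worlds M \<and> ((X, n), (Y, m)) \<in> acc M"
proof (cases "(Y, X) \<in> E\<^sup>+")
  case True
  then have "(Y, Y) \<in> E\<^sup>+" using XY by auto
  then have "(Y, Suc n) \<in> worlds M" "((X, n), (Y, Suc n)) \<in> acc M"
    using w XY E_W[of X Y] by (auto simp: M_def)
  then show ?thesis by blast
next
  case False
  then have "(Y, 0) \<in> worlds M" "((X, n), (Y, 0)) \<in> acc M"
    using w XY E_W[of X Y] by (auto simp: M_def)
  then show ?thesis by blast
qed

lemma uspo_M: "uspo_model M"
proof -
  have "r \<in> noms \<rho>" by simp
  \<comment> \<open>Nominals outside the root default to the world of \<open>r\<close>, so every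
    nominal denotes a world.\<close>
  then have "is_model M"
    using T_root_W unfolding is_model_def M_def by (auto simp del: noms.simps)
  moreover have "\<exists>y\<in>worlds M. (x, y) \<in> acc M" if x: "x \<in> worlds M" for x
  proof -
    obtain X n where Xn: "x = (X, n)" by fastforce
    then obtain i where i: "i \<in> Q" "X = T i" using x by (auto simp: M_def W_def)
    then obtain k where k: "k \<in> Q" "At i (Dia (Nom k)) \<in> B" using Q_Ser by blast
    then have "(X, T k) \<in> E" using i by (auto simp: E_def W_def)
    then show ?thesis using acc_successor x Xn by blast
  qed
  moreover have "irrefl (acc M)" by (auto simp: irrefl_def M_def)
  moreover have "trans (acc M)"
  proof (rule transI)
    fix x y z assume xy: "(x, y) \<in> acc M" and yz: "(y, z) \<in> acc M"
    obtain X l where x: "x = (X, l)" by fastforce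
    obtain Y m where y: "y = (Y, m)" by fastforce
    obtain Z n where z: "z = (Z, n)" by fastforce
    have E: "(X, Y) \<in> E\<^sup>+" "(Y, Z) \<in> E\<^sup>+"
      and lm: "(Y, X) \<in> E\<^sup>+ \<Longrightarrow> l < m" and mn: "(Z, Y) \<in> E\<^sup>+ \<Longrightarrow> m < n"
      using xy yz by (auto simp: M_def x y z)
    \<comment> \<open>A way back from \<open>Z\<close> to \<open>X\<close> puts all three types in
      one cluster, so both edges increase the counter.\<close>
    have "l < n" if ZX: "(Z, X) \<in> E\<^sup>+"
      using lm[OF trancl_trans[OF E(2) ZX]] mn[OF trancl_trans[OF ZX E(1)]] by simp
    moreover have "(X, Z) \<in> E\<^sup>+" using trancl_trans[OF E] .
    ultimately show "(x, z) \<in> acc M" using xy yz by (auto simp: M_def x y z)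
  qed
  ultimately show ?thesis by (simp add: uspo_model_def)
qed

lemma countable_worlds: "countable (worlds M)"
proof (rule countable_subset)
  have "W \<subseteq> Pow C" by (auto simp: W_def T_def)
  then have "finite W" using finite_C finite_subset by blast
  then show "countable (W \<times> (UNIV :: nat set))" by (simp add: countable_finite)
qed (auto simp: M_def)

text \<open>One direction suffices because formulas are in negation normal form: negation meets
  atoms only, where openness of the branch decides.\<close>

lemma truth: "(X, n) \<in> worlds M \<Longrightarrow> \<psi> \<in> X \<Longrightarrow> sat M (X, n) \<psi>"
proof (induction \<psi> arbitrary: X n)
  case (Pro p)
  then show ?case by (auto simp: M_def)
next
  case (Nom a)
  then obtain i where X: "X = T i" by (auto simp: M_def W_def)
  then have "a \<in> noms \<rho>" using Nom.prems(2) noms_C[of "Nom a"] by (auto simp: T_def)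
  \<comment> \<open>The type of \<open>a\<close> lies on no cycle, so the counter is 0 and the world
    is the value of \<open>a\<close>.\<close>
  moreover have "X = T a" using X T_eqI Nom.prems(2) by blast
  ultimately show ?case using named_acyclic[of a] Nom.prems(1) by (auto simp: M_def)
next
  case (Neg \<psi>)
  have X: "X \<in> W" using Neg.prems(1) by (simp add: M_def)
  then have C: "Neg \<psi> \<in> C" using Neg.prems(2) by (auto simp: W_def T_def)
  from nnf_C[OF C] consider p where "\<psi> = Pro p" | a where "\<psi> = Nom a" by auto
  then show ?case
  proof cases
    case 1
    then show ?thesis using W_consistent_Pro[OF X] Neg.prems by (auto simp: M_def)
  next
    case 2
    then have "a \<in> noms \<rho>" using noms_C[OF C] by auto
    then show ?thesis using 2 W_consistent[OF X] root_nom_T[of a] Neg.prems by (auto simp: M_def)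
  qed
next
  case (Con \<phi> \<psi>)
  then obtain i where i: "X = T i" by (auto simp: M_def W_def)
  moreover from this have "\<phi> \<in> C" "\<psi> \<in> C"
    using Con.prems(2) subfms_C[of "Con \<phi> \<psi>"] subfms_refl by (auto simp: T_def)
  ultimately have "\<phi> \<in> X" "\<psi> \<in> X" using Con.prems(2) B_Con[of i \<phi> \<psi>] by (auto simp: T_def)
  then show ?case using Con by simp
next
  case (Dis \<phi> \<psi>)
  then obtain i where i: "X = T i" by (auto simp: M_def W_def)
  moreover from this have "\<phi> \<in> C" "\<psi> \<in> C"
    using Dis.prems(2) subfms_C[of "Dis \<phi> \<psi>"] subfms_refl by (auto simp: T_def)
  ultimately have "\<phi> \<in> X \<or> \<psi> \<in> X" using Dis.prems(2) B_Dis[of i \<phi> \<psi>] by (auto simp: T_def)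
  then show ?case using Dis by auto
next
  case (Dia \<phi>)
  then obtain i where i: "i \<in> Q" "X = T i" by (auto simp: M_def W_def)
  then obtain k k' where k: "At i (Dia (Nom k)) \<in> B" "At k \<phi> \<in> B" "k' \<in> Q" "T k' = T k"
    using Q_Dia Dia.prems(2) by blast
  have "\<phi> \<in> C" using i Dia.prems(2) subfms_C[of "Dia \<phi>"] subfms_refl by (auto simp: T_def)
  then have "\<phi> \<in> T k" using k(2) by (simp add: T_def)
  \<comment> \<open>The twin \<open>k'\<close> makes the type of the possibly blocked child a
    world.\<close>
  have "T k \<in> W" using k(3,4) by (metis W_def imageI)
  then have "(X, T k) \<in> E" using i k(1) by (auto simp: E_def)
  then obtain m where "(T k, m) \<in> worlds M" "((X, n), (T k, m)) \<in> acc M"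
    using acc_successor Dia.prems(1) by blast
  then show ?case using Dia.IH \<open>\<phi> \<in> T k\<close> by auto
next
  case (Box \<phi>)
  have "sat M v \<phi>" if v: "((X, n), v) \<in> acc M" for v
  proof -
    obtain Y m where Y: "v = (Y, m)" by fastforce
    then have "(X, Y) \<in> E\<^sup>+" "(Y, m) \<in> worlds M" using v by (auto simp: M_def)
    then show ?thesis using Box E_Box Y by blast
  qed
  then show ?case by simp
next
  case (At a \<phi>)
  then obtain i where i: "X = T i" by (auto simp: M_def W_def)
  then have C: "At a \<phi> \<in> C" using At.prems(2) by (simp add: T_def)
  then have a: "a \<in> noms \<rho>" using noms_C[of "At a \<phi>"] by auto
  have "\<phi> \<in> C" using C subfms_C[of "At a \<phi>"] subfms_refl by auto
  then have "\<phi> \<in> T a" using i At.prems(2) B_At[of i a \<phi>] by (auto simp: T_def)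
  moreover have "(T a, 0) \<in> worlds M" using T_root_W[OF a] by (simp add: M_def)
  ultimately have "sat M (T a, 0) \<phi>" using At.IH by blast
  then show ?case using a by (simp add: M_def)
qed

lemma countermodel: "\<exists>w\<in>worlds M. sat M w \<chi>"
proof -
  have "At r \<chi> \<in> B" by (auto simp: B_def fms_def)
  then have "\<chi> \<in> T r" using subfms_refl by (auto simp: T_def C_def)
  moreover have "(T r, 0) \<in> worlds M" using T_root_W[of r] by (simp add: M_def)
  ultimately show ?thesis using truth by blast
qed

end

theorem theorem4p6:
  fixes \<phi> :: fm
  assumes "infinite (UNIV :: 'w set)"
    and "uspo_valid TYPE('w) \<phi>"
  shows "provable \<phi>"
proof (rule ccontr)
  assume not_provable: "\<not> provable \<phi>"
  obtain r where r: "r \<notin> noms \<phi>"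
    using finite_noms ex_new_if_finite infinite_UNIV_nat by blast
  have "\<not> closable (At r (neg \<phi>)) []" using closable_provable r not_provable by blast
  then obtain \<Theta> where "fair_branch r (neg \<phi>) \<Theta>"
    using fair_branch_exists is_nnf_nnf_neg by blast
  then interpret fair_branch r "neg \<phi>" \<Theta> .
  obtain w where w: "w \<in> worlds M" "sat M w (neg \<phi>)" using countermodel by blast
  \<comment> \<open>The countermodel has worlds in \<open>fm set \<times> nat\<close>; countability
    carries validity over \<open>'w\<close> to it.\<close>
  have "sat M w \<phi>" by (rule uspo_valid_countable[OF assms uspo_M countable_worlds w(1)])
  then show False using w(2) by (simp add: sat_nnf_neg)
qed

end
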